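(* Let $T$ be any MacMahon cube (the target). Among the $\binom{30}{8}=5852925$ collections of eight distinct MacMahon cubes, exactly $133680$ have positive solution number for $T$. The maximum solution number for $T$ over all collections is $16$, attained by exactly $81$ collections, and the minimum positive solution number is $2$, attained by exactly $93000$ collections.
   Context: A MacMahon cube is a cube whose six faces are painted with the six colors $1,2,\dots,6$, each color used on exactly one face, considered up to rotation; there are exactly $30$ MacMahon cubes. At each of the $8$ vertices of a cube three faces meet; reading their colors clockwise as seen from outside the cube gives a cyclically ordered triple, and the corner number of that vertex is the cyclic rotation of this triple whose three-digit value is smallest. Each MacMahon cube has $8$ distinct corner numbers. A collection is a set of eight distinct MacMahon cubes (the target may or may not belong to it). For a target MacMahon cube $T$ and a collection $W$, a solution is a bijection $\sigma$ from $W$ to the set of $8$ corner numbers of $T$ such that, for each $C\in W$, $\sigma(C)$ is a corner number of $C$; this corresponds to placing each cube $C$ at the corner of a $2\times2\times2$ block corresponding to $\sigma(C)$ so that the outside of the block is colored like an enlarged copy of $T$ (no condition is imposed on touching interior faces). The solution number of $W$ for $T$ is the number of solutions. *)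

theory Defs
  imports Main "HOL-Library.FuncSet"
begin

datatype face = Up | Down | Front | Back | Left | Right

fun turn_vertical :: "face \<Rightarrow> face" where
  "turn_vertical Up = Up"
| "turn_vertical Down = Down"
| "turn_vertical Front = Right"
| "turn_vertical Right = Back"
| "turn_vertical Back = Left"
| "turn_vertical Left = Front"

fun turn_horizontal :: "face \<Rightarrow> face" where
  "turn_horizontal Left = Left"
| "turn_horizontal Right = Right"
| "turn_horizontal Up = Front"
| "turn_horizontal Front = Down"
| "turn_horizontal Down = Back"
| "turn_horizontal Back = Up"

text \<open>The quarter turns about two perpendicular axes generate all 24 rotations of the cube.\<close>

inductive_set rotations :: "(face \<Rightarrow> face) set" where
  rotation_id: "id \<in> rotations"
| rotation_vertical: "r \<in> rotations \<Longrightarrow> turn_vertical \<circ> r \<in> rotations"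
| rotation_horizontal: "r \<in> rotations \<Longrightarrow> turn_horizontal \<circ> r \<in> rotations"

definition colorings :: "(face \<Rightarrow> nat) set" where
  "colorings = {c. bij_betw c UNIV {1..6}}"

definition rotation_rel :: "((face \<Rightarrow> nat) \<times> (face \<Rightarrow> nat)) set" where
  "rotation_rel = {(c, d). c \<in> colorings \<and> d \<in> colorings \<and> (\<exists>r\<in>rotations. d = c \<circ> r)}"

type_synonym cube = "(face \<Rightarrow> nat) set"

definition macmahon_cubes :: "cube set" where
  "macmahon_cubes = colorings // rotation_rel"

text \<open>The three faces at each vertex, in clockwise order as seen from outside the cube.\<close>

definition vertices :: "(face \<times> face \<times> face) set" where
  "vertices = {(Up, Right, Front), (Up, Front, Left), (Up, Left, Back), (Up, Back, Right),
     (Down, Front, Right), (Down, Left, Front), (Down, Back, Left), (Down, Right, Back)}"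

definition three_digit :: "nat \<Rightarrow> nat \<Rightarrow> nat \<Rightarrow> nat" where
  "three_digit a b c = 100 * a + 10 * b + c"

definition corner_number :: "nat \<Rightarrow> nat \<Rightarrow> nat \<Rightarrow> nat" where
  "corner_number a b c = Min {three_digit a b c, three_digit b c a, three_digit c a b}"

definition coloring_corner_numbers :: "(face \<Rightarrow> nat) \<Rightarrow> nat set" where
  "coloring_corner_numbers c = (\<lambda>(f, g, h). corner_number (c f) (c g) (c h)) ` vertices"

text \<open>All colorings representing a cube have the same corner numbers
  (lemma \<open>corner_numbers_eq\<close> below), so the union is the common value.\<close>

definition corner_numbers :: "cube \<Rightarrow> nat set" where
  "corner_numbers C = (\<Union>c\<in>C. coloring_corner_numbers c)"

definition collections :: "cube set set" where
  "collections = {W. W \<subseteq> macmahon_cubes \<and> card W = 8}"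

text \<open>Solutions are taken extensional, so that each bijection on \<open>W\<close> is counted once.\<close>

definition solutions :: "cube \<Rightarrow> cube set \<Rightarrow> (cube \<Rightarrow> nat) set" where
  "solutions T W = {\<sigma> \<in> extensional W. bij_betw \<sigma> W (corner_numbers T) \<and>
     (\<forall>C\<in>W. \<sigma> C \<in> corner_numbers C)}"

definition solution_number :: "cube \<Rightarrow> cube set \<Rightarrow> nat" where
  "solution_number T W = card (solutions T W)"

lemma corner_number_rotate: "corner_number b c a = corner_number a b c"
  unfolding corner_number_def by (rule arg_cong[where f = Min]) auto

lemma coloring_corner_numbers_turn:
  "coloring_corner_numbers (c \<circ> turn_vertical) = coloring_corner_numbers c"
  "coloring_corner_numbers (c \<circ> turn_horizontal) = coloring_corner_numbers c"
proof -
  have *: "coloring_corner_numbers d =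
    {corner_number (d Up) (d Right) (d Front), corner_number (d Up) (d Front) (d Left),
     corner_number (d Up) (d Left) (d Back), corner_number (d Up) (d Back) (d Right),
     corner_number (d Down) (d Front) (d Right), corner_number (d Down) (d Left) (d Front),
     corner_number (d Down) (d Back) (d Left), corner_number (d Down) (d Right) (d Back)}" for d
    by (simp add: coloring_corner_numbers_def vertices_def)
  show "coloring_corner_numbers (c \<circ> turn_vertical) = coloring_corner_numbers c"
    unfolding * by auto
  show "coloring_corner_numbers (c \<circ> turn_horizontal) = coloring_corner_numbers c"
    unfolding * comp_def turn_horizontal.simps
    by (simp only: corner_number_rotate[of "c Front" "c Right" "c Up"]
        corner_number_rotate[of "c Right" "c Up" "c Front"]
        corner_number_rotate[of "c Right" "c Front" "c Up"]
        corner_number_rotate[of "c Front" "c Up" "c Right"]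
        corner_number_rotate[of "c Front" "c Left" "c Up"]
        corner_number_rotate[of "c Left" "c Up" "c Front"]
        corner_number_rotate[of "c Left" "c Back" "c Up"]
        corner_number_rotate[of "c Back" "c Up" "c Left"]
        corner_number_rotate[of "c Back" "c Right" "c Up"]
        corner_number_rotate[of "c Right" "c Up" "c Back"]
        corner_number_rotate[of "c Front" "c Right" "c Down"]
        corner_number_rotate[of "c Right" "c Down" "c Front"]
        corner_number_rotate[of "c Left" "c Front" "c Down"]
        corner_number_rotate[of "c Front" "c Down" "c Left"]
        corner_number_rotate[of "c Back" "c Left" "c Down"]
        corner_number_rotate[of "c Left" "c Down" "c Back"]
        corner_number_rotate[of "c Right" "c Back" "c Down"]
        corner_number_rotate[of "c Back" "c Down" "c Right"]) auto
qed

lemma coloring_corner_numbers_rotation: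
  assumes "r \<in> rotations"
  shows "coloring_corner_numbers (c \<circ> r) = coloring_corner_numbers c"
  using assms
proof (induction arbitrary: c)
  case rotation_id
  show ?case by simp
next
  case (rotation_vertical r)
  from rotation_vertical.IH[of "c \<circ> turn_vertical"] show ?case
    by (simp only: comp_assoc coloring_corner_numbers_turn)
next
  case (rotation_horizontal r)
  from rotation_horizontal.IH[of "c \<circ> turn_horizontal"] show ?case
    by (simp only: comp_assoc coloring_corner_numbers_turn)
qed

lemma corner_numbers_eq:
  assumes "C \<in> macmahon_cubes" "c \<in> C"
  shows "corner_numbers C = coloring_corner_numbers c"
proof -
  from assms(1) obtain d where "C = rotation_rel `` {d}"
    unfolding macmahon_cubes_def by (rule quotientE)
  then have "coloring_corner_numbers e = coloring_corner_numbers d" if "e \<in> C" for e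
    using that coloring_corner_numbers_rotation unfolding rotation_rel_def by auto
  with assms(2) show ?thesis
    unfolding corner_numbers_def by auto
qed

end

theory Submission
  imports Defs
begin

text \<open>A cube other than the target either shares no corner number with it or exactly two. The twenty
  cubes of the second kind are thus edges of a multigraph on the eight vertices of the target; it
  consists of the twelve edges of a cube and of its four space diagonals, the latter doubled. A
  solution for a set of edges assigns to each edge one of its endpoints, each vertex being used once.
  Hence every component must contain exactly one cycle, and it then contributes a factor 2; if the
  target itself belongs to the collection, exactly one component is a tree, and it contributes its
  number of vertices. So the number of solutions is determined by the component structure, which
  can be updated edge by edge, and the collections are counted by a recursion over the twenty edges
  in which sets of edges with the same component structure are merged.\<close>

subsection \<open>Matchings\<close>

text \<open>In a solution every edge is used at a vertex of its own component. Without the target,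
  each component therefore has as many edges as vertices, that is, exactly one cycle, and an
  orientation of this cycle fixes the rest. The target fits at every vertex, so it serves the one
  component that is an edge short. A set with a solution has exactly eight members: of
  \<open>U\<close> and \<open>insert T U\<close> at most one has a solution, so adding their two
  counts reduces the problem to the 2^20 edge sets \<open>U\<close>. These are far more than the
  component structures, hence the merging. All cyclic components may share one label, because none
  of their vertices can stay uncovered and any further edge within or between them leaves more edges
  than vertices.\<close>

definition matchings :: "('c \<Rightarrow> 'v set) \<Rightarrow> 'c set \<Rightarrow> 'v set \<Rightarrow> ('c \<Rightarrow> 'v) set" where
  "matchings I W S = {\<sigma> \<in> extensional W. bij_betw \<sigma> W S \<and> (\<forall>C\<in>W. \<sigma> C \<in> I C)}"

lemma finite_matchings:
  assumes "finite W" "finite S"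
  shows "finite (matchings I W S)"
proof (rule finite_subset)
  show "matchings I W S \<subseteq> W \<rightarrow>\<^sub>E S"
    by (auto simp: matchings_def bij_betw_def PiE_def)
  show "finite (W \<rightarrow>\<^sub>E S)"
    using assms by (intro finite_PiE)
qed

lemma card_eq_if_matching:
  assumes "card (matchings I W S) > 0"
  shows "card W = card S"
proof -
  have "matchings I W S \<noteq> {}"
    using assms by force
  then show ?thesis
    by (auto simp: matchings_def dest: bij_betw_same_card)
qed

lemma incident_if_matching:
  assumes "card (matchings I W S) > 0" "C \<in> W"
  shows "I C \<inter> S \<noteq> {}"
proof -
  obtain \<sigma> where "\<sigma> \<in> matchings I W S"
    using assms(1) by (metis card.empty equals0I less_irrefl)
  then show ?thesis
    using assms(2) by (auto simp: matchings_def bij_betw_def)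
qed

lemma card_matchings_empty: "card (matchings I {} S) = (if S = {} then 1 else 0)"
proof -
  have "matchings I {} S = (if S = {} then {\<lambda>_. undefined} else {})"
    by (auto simp: matchings_def bij_betw_def extensional_def)
  then show ?thesis by simp
qed

text \<open>Expansion by the vertex assigned to \<open>C\<close>, as for a permanent along a row.
  All later counts go through this recursion.\<close>

lemma card_matchings_insert:
  assumes "C \<notin> W" "finite W" "finite S"
  shows "card (matchings I (insert C W) S) = (\<Sum>x\<in>I C \<inter> S. card (matchings I W (S - {x})))"
proof -
  let ?ext = "\<lambda>x. (\<lambda>\<sigma>. \<sigma>(C := x)) ` matchings I W (S - {x})"
  have eq: "matchings I (insert C W) S = (\<Union>x\<in>I C \<inter> S. ?ext x)"
  proof (intro equalityI subsetI)
    fix \<sigma> assume \<sigma>: "\<sigma> \<in> matchings I (insert C W) S"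
    then have bij: "bij_betw \<sigma> (insert C W) S"
      by (simp add: matchings_def)
    then have "bij_betw \<sigma> W (S - {\<sigma> C})"
      using assms(1) by (auto simp: bij_betw_def inj_on_def)
    \<comment> \<open>Matchings of \<open>W\<close> are extensional, so restricting \<sigma> to
      \<open>W\<close> means resetting its value at \<open>C\<close> to
      \<open>undefined\<close>.\<close>
    moreover have "bij_betw (\<sigma>(C := undefined)) W (S - {\<sigma> C}) = bij_betw \<sigma> W (S - {\<sigma> C})"
      using assms(1) by (intro bij_betw_cong) auto
    ultimately have "\<sigma>(C := undefined) \<in> matchings I W (S - {\<sigma> C})"
      using \<sigma> assms(1) by (auto simp: matchings_def extensional_def)
    moreover have "\<sigma> = (\<sigma>(C := undefined))(C := \<sigma> C)" by simp
    moreover have "\<sigma> C \<in> I C \<inter> S"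
      using \<sigma> bij by (auto simp: matchings_def bij_betw_def)
    ultimately show "\<sigma> \<in> (\<Union>x\<in>I C \<inter> S. ?ext x)" by blast
  next
    fix \<tau> assume "\<tau> \<in> (\<Union>x\<in>I C \<inter> S. ?ext x)"
    then obtain x \<sigma> where x: "x \<in> I C" "x \<in> S" and \<sigma>: "\<sigma> \<in> matchings I W (S - {x})"
      and \<tau>: "\<tau> = \<sigma>(C := x)" by blast
    have "bij_betw \<tau> W (S - {x}) = bij_betw \<sigma> W (S - {x})"
      using assms(1) \<tau> by (intro bij_betw_cong) auto
    then have "bij_betw \<tau> (W \<union> {C}) ((S - {x}) \<union> {\<tau> C})"
      using \<sigma> \<tau> assms(1) by (intro iffD1[OF notIn_Un_bij_betw3]) (auto simp: matchings_def)
    then have "bij_betw \<tau> (insert C W) S"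
      using x(2) \<tau> by (simp add: insert_absorb)
    then show "\<tau> \<in> matchings I (insert C W) S"
      using \<sigma> \<tau> x assms(1) by (auto simp: matchings_def extensional_def)
  qed
  have "inj_on (\<lambda>\<sigma>. \<sigma>(C := x)) (matchings I W S')" for x S'
  proof (rule inj_onI)
    fix \<sigma> \<tau> assume *: "\<sigma> \<in> matchings I W S'" "\<tau> \<in> matchings I W S'" "\<sigma>(C := x) = \<tau>(C := x)"
    then have "\<sigma> C = \<tau> C"
      using assms(1) by (simp add: matchings_def extensional_def)
    with *(3) show "\<sigma> = \<tau>"
      by (metis fun_upd_triv fun_upd_upd)
  qed
  then have "card (?ext x) = card (matchings I W (S - {x}))" for x
    by (intro card_image)
  moreover have "card (\<Union>x\<in>I C \<inter> S. ?ext x) = (\<Sum>x\<in>I C \<inter> S. card (?ext x))"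
  proof (rule card_UN_disjoint)
    show "\<forall>x\<in>I C \<inter> S. finite (?ext x)"
      using assms by (auto intro!: finite_matchings)
    show "\<forall>x\<in>I C \<inter> S. \<forall>y\<in>I C \<inter> S. x \<noteq> y \<longrightarrow> ?ext x \<inter> ?ext y = {}"
      by (auto dest: fun_upd_eqD)
  qed (use assms(3) in simp)
  ultimately show ?thesis
    by (simp add: eq)
qed

text \<open>This allows the corner numbers of the target to be replaced by the indices below 8. Both
  sides obey the same expansion, so only cardinalities are compared.\<close>

lemma card_matchings_image:
  assumes "inj_on v V" "finite V" "S \<subseteq> V" "finite W"
  shows "card (matchings I W (v ` S)) = card (matchings (\<lambda>C. {x \<in> V. v x \<in> I C}) W S)"
  using assms(4,3)
proof (induction W arbitrary: S)
  case empty
  then show ?case by (simp add: card_matchings_empty)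
next
  case (insert C W)
  have fin: "finite S"
    using insert.prems assms(2) finite_subset by blast
  have inj: "inj_on v S"
    using assms(1) insert.prems inj_on_subset by blast
  have "card (matchings I (insert C W) (v ` S)) = (\<Sum>y\<in>I C \<inter> v ` S. card (matchings I W (v ` S - {y})))"
    using insert.hyps fin by (simp add: card_matchings_insert)
  also have "I C \<inter> v ` S = v ` {x \<in> S. v x \<in> I C}" by auto
  also have "(\<Sum>y\<in>v ` {x \<in> S. v x \<in> I C}. card (matchings I W (v ` S - {y}))) =
    (\<Sum>x\<in>{x \<in> S. v x \<in> I C}. card (matchings I W (v ` S - {v x})))"
    using inj by (subst sum.reindex) (auto intro: inj_on_subset)
  also have "\<dots> = (\<Sum>x\<in>{x \<in> S. v x \<in> I C}. card (matchings (\<lambda>C. {x \<in> V. v x \<in> I C}) W (S - {x})))"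
  proof (rule sum.cong[OF refl])
    fix x assume "x \<in> {x \<in> S. v x \<in> I C}"
    then have "v ` S - {v x} = v ` (S - {x})"
      using inj by (auto simp: inj_on_def)
    then show "card (matchings I W (v ` S - {v x})) =
        card (matchings (\<lambda>C. {x \<in> V. v x \<in> I C}) W (S - {x}))"
      using insert.IH[of "S - {x}"] insert.prems by auto
  qed
  also have "{x \<in> S. v x \<in> I C} = {x \<in> V. v x \<in> I C} \<inter> S"
    using insert.prems by auto
  finally show ?case
    using insert.hyps fin by (simp add: card_matchings_insert)
qed

subsection \<open>Component labellings\<close>

datatype comparison = LT | EQ | GT

fun compare :: "nat \<Rightarrow> nat \<Rightarrow> comparison" where
  "compare 0 0 = EQ"
| "compare 0 (Suc b) = LT"
| "compare (Suc a) 0 = GT"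
| "compare (Suc a) (Suc b) = compare a b"

lemma compare_eq: "compare a b = (if a = b then EQ else if a < b then LT else GT)"
  by (induction a b rule: compare.induct) auto

text \<open>In \<open>State c ls\<close> the list \<open>ls\<close> assigns to each vertex the label of its component, where the
  label 0 marks the components that contain a cycle. The functions on states dispatch on
  constructors only, without conditionals or abstractions: this keeps \<open>code_simp\<close> fast.\<close>

datatype state = State nat "nat list"

fun choose_label :: "comparison \<Rightarrow> nat \<Rightarrow> nat \<Rightarrow> nat" where
  "choose_label LT b l = l"
| "choose_label GT b l = l"
| "choose_label EQ b l = b"

fun relabel :: "nat \<Rightarrow> nat \<Rightarrow> nat list \<Rightarrow> nat list" where
  "relabel a b [] = []"
| "relabel a b (l # ls) = choose_label (compare a l) b l # relabel a b ls"

lemma relabel_eq: "relabel a b ls = map (\<lambda>l. if l = a then b else l) ls"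
  by (induction ls) (auto simp: compare_eq)

text \<open>The smaller label survives. Starting from \<open>[1..<Suc n]\<close>, a tree thus
  carries its least vertex plus one, and states with the same trees and the same weight are equal as
  data. As 0 lies below all tree labels, the same rule makes a tree cyclic when it is attached to a
  cyclic component.\<close>

fun join :: "comparison \<Rightarrow> nat \<Rightarrow> nat \<Rightarrow> nat \<Rightarrow> nat list \<Rightarrow> state" where
  "join LT a b c ls = State c (relabel b a ls)"
| "join GT a b c ls = State c (relabel a b ls)"
| "join EQ 0 b c ls = State 0 ls"
| "join EQ (Suc a) b c ls = State (c + c) (relabel (Suc a) 0 ls)"

fun join_labels :: "nat \<Rightarrow> nat \<Rightarrow> nat \<Rightarrow> nat list \<Rightarrow> state" where
  "join_labels a b c ls = join (compare a b) a b c ls"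

fun add_edge :: "nat \<times> nat \<Rightarrow> state \<Rightarrow> state" where
  "add_edge (x, y) (State c ls) = join_labels (ls ! x) (ls ! y) c ls"

text \<open>Here \<open>R\<close> is the set of vertices left uncovered: it must pick one vertex from each tree.\<close>

definition represents :: "('c \<Rightarrow> nat set) \<Rightarrow> nat \<Rightarrow> 'c set \<Rightarrow> state \<Rightarrow> bool" where
  "represents I n W s = (case s of State c ls \<Rightarrow> length ls = n \<and>
    (\<forall>R\<subseteq>{..<n}. card (matchings I W ({..<n} - R)) =
      (if bij_betw ((!) ls) R (set ls - {0}) then c else 0)))"

text \<open>Without edges every vertex is a tree by itself, so all of them must stay uncovered.
  Labels start at 1 because 0 is reserved for cyclic components.\<close>

lemma represents_empty: "represents I n {} (State 1 [1..<Suc n])"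
proof -
  have "R = {..<n}" if "R \<subseteq> {..<n}" "bij_betw ((!) [Suc 0..<Suc n]) R {Suc 0..<Suc n}" for R
    using that card_subset_eq[of "{..<n}" R] bij_betw_same_card[OF that(2)] by simp
  moreover have "bij_betw ((!) [Suc 0..<Suc n]) {..<n} {Suc 0..<Suc n}"
    using bij_betw_nth[of "[Suc 0..<Suc n]"] by (simp del: upt_Suc)
  moreover have "{..<n} - R = {} \<longleftrightarrow> R = {..<n}" if "R \<subseteq> {..<n}" for R :: "nat set"
    using that by auto
  moreover have "{Suc 0..<Suc n} - {0} = {Suc 0..<Suc n}" by auto
  ultimately show ?thesis
    unfolding represents_def
    by (auto simp: card_matchings_empty simp del: upt_Suc)
qed

lemma bij_betw_insert_iff:
  assumes "z \<notin> R"
  shows "bij_betw f (insert z R) L \<longleftrightarrow> f z \<in> L \<and> bij_betw f R (L - {f z})"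
  using assms by (auto simp: bij_betw_def inj_on_def)

text \<open>On either side no vertex of \<open>R\<close> can have label \<open>p\<close>: it would
  be sent to \<open>p\<close> or to 0, neither of which lies in the target set. The two functions
  then agree on \<open>R\<close>.\<close>

lemma bij_betw_relabel_zero:
  assumes "0 \<notin> L"
  shows "bij_betw (\<lambda>r. if f r = p then 0 else f r) R (L - {p}) \<longleftrightarrow> bij_betw f R (L - {p :: nat})"
proof -
  have *: "f r \<noteq> p"
    if "bij_betw f R (L - {p}) \<or> bij_betw (\<lambda>r. if f r = p then 0 else f r) R (L - {p})" "r \<in> R" for r
    using that(1)
  proof
    assume "bij_betw f R (L - {p})"
    then show ?thesis
      using bij_betwE that(2) by fastforce
  next
    assume "bij_betw (\<lambda>r. if f r = p then 0 else f r) R (L - {p})"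
    then have "(if f r = p then 0 else f r) \<in> L"
      using bij_betwE that(2) by fastforce
    then show ?thesis
      using assms by auto
  qed
  show ?thesis
  proof (cases "\<exists>r\<in>R. f r = p")
    case True
    with * show ?thesis by blast
  next
    case False
    then show ?thesis by (intro bij_betw_cong) auto
  qed
qed

text \<open>Here the trees \<open>p\<close> and \<open>q\<close> are merged under the label
  \<open>q\<close>. The one vertex picked from the merged tree comes either from the old
  \<open>q\<close>, so that \<open>p\<close> is missed, or from the old \<open>p\<close>, so that
  \<open>q\<close> is missed.\<close>

lemma bij_betw_relabel:
  assumes "p \<in> L" "q \<in> L" "p \<noteq> q"
  shows "bij_betw (\<lambda>r. if f r = p then q else f r) R (L - {p}) \<longleftrightarrow>
    bij_betw f R (L - {p}) \<or> bij_betw f R (L - {q})"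
proof
  let ?g = "\<lambda>r. if f r = p then q else f r"
  assume g: "bij_betw ?g R (L - {p})"
  then have inj: "inj_on f R"
    by (auto simp: bij_betw_def inj_on_def)
  have im: "?g ` R = L - {p}"
    using g by (simp add: bij_betw_def)
  show "bij_betw f R (L - {p}) \<or> bij_betw f R (L - {q})"
  proof (cases "p \<in> f ` R")
    case True
    then obtain r where r: "r \<in> R" "f r = p" by auto
    have nq: "f u \<noteq> q" if "u \<in> R" for u
    proof
      assume u: "f u = q"
      then have "?g u = ?g r"
        using r assms(3) by simp
      then have "u = r"
        using g that r(1) unfolding bij_betw_def inj_on_def by blast
      with u r assms(3) show False by simp
    qed
    have "f ` R = L - {q}"
    proof (intro equalityI subsetI)
      fix l assume "l \<in> f ` R"
      then obtain u where u: "u \<in> R" "l = f u" by auto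
      then have "?g u \<in> L" using im by blast
      then show "l \<in> L - {q}"
        using u nq assms(1) by (auto split: if_splits)
    next
      fix l assume l: "l \<in> L - {q}"
      show "l \<in> f ` R"
      proof (cases "l = p")
        case True
        then show ?thesis using r by auto
      next
        case False
        then have "l \<in> ?g ` R" using l im by blast
        then show ?thesis using l by (auto split: if_splits)
      qed
    qed
    then show ?thesis
      using inj by (simp add: bij_betw_def)
  next
    case False
    then have "?g ` R = f ` R"
      by (intro image_cong) auto
    then show ?thesis
      using inj im by (simp add: bij_betw_def)
  qed
next
  let ?g = "\<lambda>r. if f r = p then q else f r"
  assume "bij_betw f R (L - {p}) \<or> bij_betw f R (L - {q})"
  then show "bij_betw ?g R (L - {p})"
  proof
    assume f: "bij_betw f R (L - {p})"
    then have "f r \<noteq> p" if "r \<in> R" for r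
      using bij_betwE that by fastforce
    then have "bij_betw ?g R (L - {p}) = bij_betw f R (L - {p})"
      by (intro bij_betw_cong) simp
    with f show ?thesis by simp
  next
    assume f: "bij_betw f R (L - {q})"
    have "bij_betw (\<lambda>l. if l = p then q else l) (L - {q}) (L - {p})"
      using assms by (intro bij_betwI[where g = "\<lambda>l. if l = q then p else l"]) auto
    from bij_betw_trans[OF f this] show ?thesis
      by (simp add: comp_def)
  qed
qed

text \<open>Merging two trees keeps the number of choices, closing a cycle doubles it (the cycle has two
  orientations), and a second cycle in a component leaves no matching.\<close>

lemma represents_add_edge:
  assumes s: "represents I n W s" and W: "finite W" "C \<notin> W"
    and IC: "I C = {x, y}" "x \<noteq> y" "x < n" "y < n"
  shows "represents I n (insert C W) (add_edge (x, y) s)"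
proof -
  obtain c ls where s_eq: "s = State c ls" by (cases s)
  define L where "L = set ls - {0}"
  define a where "a = ls ! x"
  define b where "b = ls ! y"
  have len: "length ls = n"
    using s by (simp add: represents_def s_eq)
  have prev: "card (matchings I W ({..<n} - R)) = (if bij_betw ((!) ls) R L then c else 0)"
    if "R \<subseteq> {..<n}" for R
    using s that by (simp add: represents_def s_eq L_def)
  have ab: "a \<in> set ls" "b \<in> set ls"
    using IC len by (auto simp: a_def b_def)
  have L: "0 \<notin> L" "a \<noteq> 0 \<Longrightarrow> a \<in> L" "b \<noteq> 0 \<Longrightarrow> b \<in> L"
    using ab by (auto simp: L_def)
  \<comment> \<open>\<open>t p R\<close> is the contribution of an endpoint labelled
    \<open>p\<close> that the new edge takes: \<open>W\<close> leaves it uncovered as the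
    representative of its tree, so \<open>R\<close> must represent the other trees. Label 0
    contributes nothing, as a cyclic component has no vertex to spare.\<close>
  define t where "t p R = (if p \<noteq> 0 \<and> bij_betw ((!) ls) R (L - {p}) then c else 0)" for p R
  have count: "card (matchings I (insert C W) ({..<n} - R)) = t a R + t b R" if R: "R \<subseteq> {..<n}" for R
  proof -
    have term_eq: "(if z \<in> R then 0 else card (matchings I W ({..<n} - R - {z}))) = t (ls ! z) R"
      if z: "z < n" for z
    proof (cases "z \<in> R")
      case True
      then have "\<not> bij_betw ((!) ls) R (L - {ls ! z})"
        using bij_betwE by fastforce
      with True show ?thesis by (simp add: t_def)
    next
      case False
      have "{..<n} - R - {z} = {..<n} - insert z R" by auto
      moreover have "ls ! z \<in> L \<longleftrightarrow> ls ! z \<noteq> 0"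
        using z len by (auto simp: L_def)
      ultimately show ?thesis
        using False z R prev[of "insert z R"] by (auto simp: t_def bij_betw_insert_iff)
    qed
    have "card (matchings I (insert C W) ({..<n} - R)) =
        (\<Sum>z\<in>{x, y} \<inter> ({..<n} - R). card (matchings I W ({..<n} - R - {z})))"
      using W by (simp add: card_matchings_insert IC(1))
    also have "\<dots> = (\<Sum>z\<in>{x, y}. if z \<in> R then 0 else card (matchings I W ({..<n} - R - {z})))"
      using IC by (intro sum.mono_neutral_cong_left) auto
    also have "\<dots> = (\<Sum>z\<in>{x, y}. t (ls ! z) R)"
      using IC by (intro sum.cong term_eq) auto
    finally show ?thesis
      using IC(2) by (simp add: a_def b_def)
  qed
  \<comment> \<open>In every case that changes labels, what remains is an identity between the two
    endpoint contributions and the new weight.\<close>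
  have relabelled: "represents I n (insert C W) (State d (relabel p q ls))"
    if "p \<in> L" "q = 0 \<or> q \<in> L" "p \<noteq> q"
      "\<And>R. t a R + t b R = (if bij_betw (\<lambda>r. if ls ! r = p then q else ls ! r) R (L - {p}) then d else 0)"
    for p q d
  proof -
    have "set (relabel p q ls) - {0} = L - {p}"
      using that by (auto simp: relabel_eq L_def)
    moreover have "bij_betw ((!) (relabel p q ls)) R A =
        bij_betw (\<lambda>r. if ls ! r = p then q else ls ! r) R A" if "R \<subseteq> {..<n}" for R A
      using that len by (intro bij_betw_cong) (auto simp: relabel_eq)
    ultimately show ?thesis
      using len by (simp add: represents_def count that(4)) (simp add: relabel_eq)
  qed
  \<comment> \<open>A set \<open>R\<close> misses the tree \<open>a\<close> or the tree
    \<open>b\<close>, but not both alternatives at once. At most one endpoint contributes, which is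
    why merging keeps the weight.\<close>
  have separate: "\<not> (bij_betw ((!) ls) R (L - {a}) \<and> bij_betw ((!) ls) R (L - {b}))"
    if "a \<noteq> b" "a \<noteq> 0 \<or> b \<noteq> 0" for R
    using that L by (auto simp: bij_betw_def)
  consider "a = 0" "b = 0" | "a = b" "a \<noteq> 0" | "a < b" | "b < a"
    by linarith
  then show ?thesis
  proof cases
    case 1
    then have "add_edge (x, y) s = State 0 ls"
      by (simp add: s_eq compare_eq flip: a_def b_def)
    then show ?thesis
      using len 1 by (simp add: represents_def count t_def)
  next
    case 2
    have "join EQ a b c ls = State (c + c) (relabel a 0 ls)"
      using 2(2) by (cases a) simp_all
    then have "add_edge (x, y) s = State (c + c) (relabel a 0 ls)"
      using 2(1) by (simp add: s_eq compare_eq flip: a_def b_def)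
    moreover have "represents I n (insert C W) (State (c + c) (relabel a 0 ls))"
      using 2 L by (intro relabelled) (auto simp: t_def bij_betw_relabel_zero)
    ultimately show ?thesis by simp
  next
    case 3
    then have "add_edge (x, y) s = State c (relabel b a ls)"
      by (simp add: s_eq compare_eq flip: a_def b_def)
    moreover have "represents I n (insert C W) (State c (relabel b a ls))"
    proof (cases "a = 0")
      case True
      then show ?thesis
        using 3 L by (intro relabelled) (auto simp: t_def bij_betw_relabel_zero)
    next
      case False
      then show ?thesis
        using 3 L separate by (intro relabelled) (auto simp: t_def bij_betw_relabel)
    qed
    ultimately show ?thesis by simp
  next
    case 4
    then have "add_edge (x, y) s = State c (relabel a b ls)"
      by (simp add: s_eq compare_eq flip: a_def b_def)
    moreover have "represents I n (insert C W) (State c (relabel a b ls))"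
    proof (cases "b = 0")
      case True
      then show ?thesis
        using 4 L by (intro relabelled) (auto simp: t_def bij_betw_relabel_zero)
    next
      case False
      then show ?thesis
        using 4 L separate by (intro relabelled) (auto simp: t_def bij_betw_relabel)
    qed
    ultimately show ?thesis by simp
  qed
qed

subsection \<open>Counting edge sets by their number of matchings\<close>

fun nonzero_labels :: "nat list \<Rightarrow> nat list" where
  "nonzero_labels [] = []"
| "nonzero_labels (0 # ls) = nonzero_labels ls"
| "nonzero_labels (Suc l # ls) = Suc l # nonzero_labels ls"

fun constant_sum :: "comparison \<Rightarrow> nat \<Rightarrow> nat \<Rightarrow> nat \<Rightarrow> nat list \<Rightarrow> nat" where
  "constant_sum LT c k l ls = 0"
| "constant_sum GT c k l ls = 0"
| "constant_sum EQ c k l [] = k"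
| "constant_sum EQ c k l (l' # ls) = constant_sum (compare l l') c (k + c) l ls"

text \<open>The value is \<open>c\<close> if no tree is left, \<open>c\<close> times the number of
  vertices if one tree is left, and 0 if there are several.\<close>

fun labels_value :: "nat \<Rightarrow> nat list \<Rightarrow> nat" where
  "labels_value c [] = c"
| "labels_value c (l # ls) = constant_sum EQ c c l ls"

fun state_value :: "state \<Rightarrow> nat" where
  "state_value (State c ls) = labels_value c (nonzero_labels ls)"

lemma nonzero_labels_eq: "nonzero_labels ls = filter (\<lambda>l. l \<noteq> 0) ls"
  by (induction ls rule: nonzero_labels.induct) auto

lemma constant_sum_EQ:
  "constant_sum EQ c k l ls = (if \<forall>l'\<in>set ls. l' = l then k + c * length ls else 0)"
  by (induction ls arbitrary: k) (auto simp: compare_eq)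

lemma state_value_eq:
  "state_value (State c ls) = (if set ls - {0} = {} then c else 0) +
    (\<Sum>x<length ls. if set ls - {0} = {ls ! x} then c else 0)"
proof (cases "nonzero_labels ls")
  case Nil
  then have zero: "set ls - {0} = {}"
    by (auto simp: nonzero_labels_eq filter_empty_conv)
  with Nil show ?thesis by auto
next
  case (Cons l ks)
  have "set ls - {0} = set (nonzero_labels ls)"
    by (auto simp: nonzero_labels_eq)
  then have set_eq: "set ls - {0} = insert l (set ks)"
    by (simp add: Cons)
  show ?thesis
  proof (cases "\<forall>l'\<in>set ks. l' = l")
    case True
    then have single: "set ls - {0} = {l}"
      using set_eq by auto
    have mem: "k \<in> set ls - {0} \<longleftrightarrow> k = l" for k
      unfolding single by simp
    have "k = l \<longleftrightarrow> k \<noteq> 0" if "k \<in> set ls" for k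
      using that mem[of k] by auto
    then have "filter (\<lambda>k. k = l) ls = filter (\<lambda>k. k \<noteq> 0) ls"
      by (rule filter_cong[OF refl])
    then have "length (filter (\<lambda>k. k = l) ls) = Suc (length ks)"
      using Cons by (simp add: nonzero_labels_eq)
    then have "card {x. x < length ls \<and> ls ! x = l} = Suc (length ks)"
      by (simp add: length_filter_conv_card)
    moreover have "(\<Sum>x<length ls. if set ls - {0} = {ls ! x} then c else 0) =
        c * card {x. x < length ls \<and> ls ! x = l}"
      unfolding single
      by (simp add: sum.If_cases Int_def conj_commute eq_commute[of l])
    ultimately show ?thesis
      using Cons True single by (simp add: constant_sum_EQ)
  next
    case False
    then have "set ls - {0} \<noteq> {k}" for k
      using set_eq by auto
    with False set_eq Cons show ?thesis
      by (auto simp: constant_sum_EQ)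
  qed
qed

text \<open>The target can take any vertex \<open>x\<close>, and \<open>W\<close> then covers all
  vertices but \<open>x\<close>. So the first summand is the case of empty \<open>R\<close>, the
  second the sum over singletons \<open>R\<close>.\<close>

lemma state_value_represents:
  assumes "represents I n W s" "finite W" "T \<notin> W" "I T = {..<n}"
  shows "card (matchings I W {..<n}) + card (matchings I (insert T W) {..<n}) = state_value s"
proof -
  obtain c ls where s: "s = State c ls" by (cases s)
  have len: "length ls = n"
    using assms(1) by (simp add: represents_def s)
  have prev: "card (matchings I W ({..<n} - R)) = (if bij_betw ((!) ls) R (set ls - {0}) then c else 0)"
    if "R \<subseteq> {..<n}" for R
    using assms(1) that by (simp add: represents_def s)
  have "card (matchings I W {..<n}) = (if set ls - {0} = {} then c else 0)"
    using prev[of "{}"] by (auto simp: bij_betw_def)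
  moreover have "card (matchings I (insert T W) {..<n}) =
      (\<Sum>x<n. if set ls - {0} = {ls ! x} then c else 0)"
  proof -
    have "card (matchings I (insert T W) {..<n}) = (\<Sum>x<n. card (matchings I W ({..<n} - {x})))"
      using assms by (simp add: card_matchings_insert)
    also have "\<dots> = (\<Sum>x<n. if set ls - {0} = {ls ! x} then c else 0)"
      by (rule sum.cong) (auto simp: prev bij_betw_def)
    finally show ?thesis .
  qed
  ultimately show ?thesis
    by (simp add: s state_value_eq len del: state_value.simps)
qed

fun num_outcomes :: "nat set \<Rightarrow> (nat \<times> nat) list \<Rightarrow> state \<Rightarrow> nat" where
  "num_outcomes X [] s = of_bool (state_value s \<in> X)"
| "num_outcomes X (e # es) s = num_outcomes X es s + num_outcomes X es (add_edge e s)"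

text \<open>\<open>W\<close> holds the edges already chosen and \<open>Cs\<close> the undecided
  ones. Omitting or taking the first of these gives the two branches of
  \<open>num_outcomes\<close>.\<close>

lemma card_subsets_eq_num_outcomes:
  assumes "list_all2 (\<lambda>C (x, y). I C = {x, y} \<and> x \<noteq> y \<and> x < n \<and> y < n) Cs es"
    and "represents I n W s" "finite W" "distinct Cs" "W \<inter> set Cs = {}"
    and "T \<notin> W" "T \<notin> set Cs" "I T = {..<n}"
  shows "card {U. U \<subseteq> set Cs \<and> card (matchings I (W \<union> U) {..<n}) +
    card (matchings I (insert T (W \<union> U)) {..<n}) \<in> X} = num_outcomes X es s"
  using assms
proof (induction Cs es arbitrary: W s rule: list_all2_induct)
  case Nil
  have "card (matchings I W {..<n}) + card (matchings I (insert T W) {..<n}) = state_value s"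
    using Nil.prems by (intro state_value_represents) simp_all
  then have "{U. U \<subseteq> set [] \<and> card (matchings I (W \<union> U) {..<n}) +
      card (matchings I (insert T (W \<union> U)) {..<n}) \<in> X} = (if state_value s \<in> X then {{}} else {})"
    by auto
  then show ?case by simp
next
  case (Cons C Cs e es)
  obtain x y where e: "e = (x, y)" by (cases e)
  define P where "P U \<longleftrightarrow> card (matchings I U {..<n}) + card (matchings I (insert T U) {..<n}) \<in> X" for U
  have "represents I n (insert C W) (add_edge e s)"
    using Cons.hyps(1) Cons.prems by (auto simp: e intro: represents_add_edge)
  then have with_C: "card {U. U \<subseteq> set Cs \<and> P (insert C W \<union> U)} = num_outcomes X es (add_edge e s)"
    using Cons.prems unfolding P_def by (intro Cons.IH) auto
  have without_C: "card {U. U \<subseteq> set Cs \<and> P (W \<union> U)} = num_outcomes X es s"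
    using Cons.prems unfolding P_def by (intro Cons.IH) auto
  have "{U. U \<subseteq> set (C # Cs) \<and> P (W \<union> U)} =
      {U. U \<subseteq> set Cs \<and> P (W \<union> U)} \<union> insert C ` {U. U \<subseteq> set Cs \<and> P (insert C W \<union> U)}"
  proof (intro equalityI subsetI)
    fix U assume U: "U \<in> {U. U \<subseteq> set (C # Cs) \<and> P (W \<union> U)}"
    show "U \<in> {U. U \<subseteq> set Cs \<and> P (W \<union> U)} \<union> insert C ` {U. U \<subseteq> set Cs \<and> P (insert C W \<union> U)}"
    proof (cases "C \<in> U")
      case True
      then have "U = insert C (U - {C})" "W \<union> U = insert C W \<union> (U - {C})" by auto
      moreover have "U - {C} \<subseteq> set Cs" using U by auto
      ultimately have "U - {C} \<in> {U. U \<subseteq> set Cs \<and> P (insert C W \<union> U)}" using U by simp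
      then show ?thesis using \<open>U = insert C (U - {C})\<close> by blast
    next
      case False
      then show ?thesis using U by auto
    qed
  qed auto
  moreover have "card (insert C ` {U. U \<subseteq> set Cs \<and> P (insert C W \<union> U)}) =
      card {U. U \<subseteq> set Cs \<and> P (insert C W \<union> U)}"
    using Cons.prems by (intro card_image inj_onI) (auto simp: set_eq_iff)
  moreover have "{U. U \<subseteq> set Cs \<and> P (W \<union> U)} \<inter>
      insert C ` {U. U \<subseteq> set Cs \<and> P (insert C W \<union> U)} = {}"
    using Cons.prems by auto
  moreover have "finite {U. U \<subseteq> set Cs \<and> Q U}" for Q
    by (rule finite_subset[of _ "Pow (set Cs)"]) auto
  ultimately have "card {U. U \<subseteq> set (C # Cs) \<and> P (W \<union> U)} = num_outcomes X (e # es) s"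
    using with_C without_C by (simp add: card_Un_disjoint)
  then show ?case by (simp add: P_def)
qed

subsection \<open>Evaluation by merging equal states\<close>

fun compare_lists :: "nat list \<Rightarrow> nat list \<Rightarrow> comparison"
  and compare_tails :: "comparison \<Rightarrow> nat list \<Rightarrow> nat list \<Rightarrow> comparison" where
  "compare_lists [] [] = EQ"
| "compare_lists [] (y # ys) = LT"
| "compare_lists (x # xs) [] = GT"
| "compare_lists (x # xs) (y # ys) = compare_tails (compare x y) xs ys"
| "compare_tails LT xs ys = LT"
| "compare_tails GT xs ys = GT"
| "compare_tails EQ xs ys = compare_lists xs ys"

fun compare_states :: "state \<Rightarrow> state \<Rightarrow> comparison" where
  "compare_states (State c xs) (State d ys) = compare_tails (compare c d) xs ys"

text \<open>The integer is the number of edge sets that lead to the state. Integers are evaluated in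
  binary, natural numbers in unary, which suits only the small labels and weights.\<close>

type_synonym layer = "(state \<times> int) list"

fun merge :: "layer \<Rightarrow> layer \<Rightarrow> layer"
  and merge_by :: "comparison \<Rightarrow> layer \<Rightarrow> layer \<Rightarrow> layer" where
  "merge [] L = L"
| "merge (p # K) [] = p # K"
| "merge ((s, m) # K) ((t, n) # L) = merge_by (compare_states s t) ((s, m) # K) ((t, n) # L)"
| "merge_by LT [] L = L"
| "merge_by LT (p # K) L = p # merge K L"
| "merge_by GT K [] = K"
| "merge_by GT K (q # L) = q # merge K L"
| "merge_by EQ [] L = L"
| "merge_by EQ (p # K) [] = p # K"
| "merge_by EQ ((s, m) # K) ((t, n) # L) = (s, m + n) # merge K L"

fun merge_pairs :: "layer list \<Rightarrow> layer list" where
  "merge_pairs [] = []"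
| "merge_pairs [L] = [L]"
| "merge_pairs (K # L # Ls) = merge K L # merge_pairs Ls"

lemma length_merge_pairs [termination_simp]: "length (merge_pairs Ls) \<le> length Ls"
  by (induction Ls rule: merge_pairs.induct) auto

fun merge_all :: "layer list \<Rightarrow> layer" where
  "merge_all [] = []"
| "merge_all [L] = L"
| "merge_all (K # L # Ls) = merge_all (merge_pairs (K # L # Ls))"

text \<open>A state of weight 0 never recovers and only yields the value 0. Dropping it is harmless
  for every \<open>X\<close> that avoids 0.\<close>

fun cons_alive :: "state \<Rightarrow> int \<Rightarrow> layer list \<Rightarrow> layer list" where
  "cons_alive (State 0 ls) m Ls = Ls"
| "cons_alive (State (Suc c) ls) m Ls = [(State (Suc c) ls, m)] # Ls"

text \<open>Adding an edge does not respect the order of states. Each result therefore becomes a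
  layer of its own, and \<open>merge_all\<close> sorts these by rounds of pairwise merging.\<close>

fun map_add_edge :: "nat \<times> nat \<Rightarrow> layer \<Rightarrow> layer list" where
  "map_add_edge e [] = []"
| "map_add_edge e ((s, m) # L) = cons_alive (add_edge e s) m (map_add_edge e L)"

fun add_edges :: "(nat \<times> nat) list \<Rightarrow> layer \<Rightarrow> layer" where
  "add_edges [] L = L"
| "add_edges (e # es) L = add_edges es (merge L (merge_all (map_add_edge e L)))"

fun tally :: "nat \<Rightarrow> int \<Rightarrow> (nat \<times> int) list \<Rightarrow> (nat \<times> int) list"
  and tally_by :: "comparison \<Rightarrow> nat \<Rightarrow> int \<Rightarrow> (nat \<times> int) list \<Rightarrow> (nat \<times> int) list" where
  "tally v m [] = [(v, m)]"
| "tally v m ((w, n) # h) = tally_by (compare v w) v m ((w, n) # h)"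
| "tally_by LT v m h = (v, m) # h"
| "tally_by EQ v m [] = [(v, m)]"
| "tally_by EQ v m ((w, n) # h) = (w, m + n) # h"
| "tally_by GT v m [] = [(v, m)]"
| "tally_by GT v m (p # h) = p # tally v m h"

fun tally_positive :: "nat \<Rightarrow> int \<Rightarrow> (nat \<times> int) list \<Rightarrow> (nat \<times> int) list" where
  "tally_positive 0 m h = h"
| "tally_positive (Suc v) m h = tally (Suc v) m h"

fun tally_outcomes :: "(nat \<times> nat) list \<Rightarrow> state \<Rightarrow> int \<Rightarrow> (nat \<times> int) list \<Rightarrow> (nat \<times> int) list" where
  "tally_outcomes [] s m h = tally_positive (state_value s) m h"
| "tally_outcomes (e # es) (State 0 ls) m h = h"
| "tally_outcomes (e # es) (State (Suc c) ls) m h =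
    tally_outcomes es (add_edge e (State (Suc c) ls)) m (tally_outcomes es (State (Suc c) ls) m h)"

fun tally_layer :: "(nat \<times> nat) list \<Rightarrow> layer \<Rightarrow> (nat \<times> int) list \<Rightarrow> (nat \<times> int) list" where
  "tally_layer es [] h = h"
| "tally_layer es ((s, m) # L) h = tally_layer es L (tally_outcomes es s m h)"

text \<open>The pairing of multiplicities with a function. It is applied to layers with
  \<open>num_outcomes\<close> and to histograms with the indicator of \<open>X\<close>, so that a
  single histogram serves all \<open>X\<close>.\<close>

definition weighted_sum :: "('a \<Rightarrow> nat) \<Rightarrow> ('a \<times> int) list \<Rightarrow> int" where
  "weighted_sum \<phi> L = (\<Sum>(s, m)\<leftarrow>L. m * int (\<phi> s))"

lemma weighted_sum_simps [simp]:
  "weighted_sum \<phi> [] = 0"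
  "weighted_sum \<phi> ((s, m) # L) = m * int (\<phi> s) + weighted_sum \<phi> L"
  by (simp_all add: weighted_sum_def)

lemma compare_lists_EQ:
  "compare_lists xs ys = EQ \<longleftrightarrow> xs = ys"
  "compare_tails r xs ys = EQ \<longleftrightarrow> r = EQ \<and> xs = ys"
  by (induction xs ys and r xs ys rule: compare_lists_compare_tails.induct) (auto simp: compare_eq)

lemma compare_states_EQ: "compare_states s t = EQ \<longleftrightarrow> s = t"
  by (cases s; cases t) (simp add: compare_lists_EQ compare_eq)

text \<open>Every branch preserves the sum, whatever the order of the lists; the order only decides
  how many equal states meet. The side condition of the second part holds when
  \<open>compare_states\<close> returns \<open>EQ\<close>.\<close>

lemma weighted_sum_merge:
  "weighted_sum \<phi> (merge K L) = weighted_sum \<phi> K + weighted_sum \<phi> L"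
  "(r = EQ \<longrightarrow> K \<noteq> [] \<longrightarrow> L \<noteq> [] \<longrightarrow> fst (hd K) = fst (hd L)) \<Longrightarrow>
    weighted_sum \<phi> (merge_by r K L) = weighted_sum \<phi> K + weighted_sum \<phi> L"
  by (induction K L and r K L rule: merge_merge_by.induct)
    (auto simp: compare_states_EQ algebra_simps)

lemma sum_weighted_sum_merge_pairs:
  "(\<Sum>L\<leftarrow>merge_pairs Ls. weighted_sum \<phi> L) = (\<Sum>L\<leftarrow>Ls. weighted_sum \<phi> L)"
  by (induction Ls rule: merge_pairs.induct) (simp_all add: weighted_sum_merge)

lemma weighted_sum_merge_all: "weighted_sum \<phi> (merge_all Ls) = (\<Sum>L\<leftarrow>Ls. weighted_sum \<phi> L)"
proof (induction Ls rule: merge_all.induct)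
  case (3 K L Ls)
  then show ?case
    by (simp only: merge_all.simps sum_weighted_sum_merge_pairs)
qed simp_all

lemma add_edge_weight_zero: "\<exists>ks. add_edge e (State 0 ls) = State 0 ks"
proof (cases e)
  case (Pair x y)
  then show ?thesis
    by (cases "(compare (ls ! x) (ls ! y), ls ! x, ls ! y, 0 :: nat, ls)" rule: join.cases) auto
qed

lemma num_outcomes_weight_zero:
  assumes "0 \<notin> X"
  shows "num_outcomes X es (State 0 ls) = 0"
proof (induction es arbitrary: ls)
  case Nil
  show ?case
    using assms by (simp add: state_value_eq del: state_value.simps)
next
  case (Cons e es)
  then show ?case
    using add_edge_weight_zero[of e ls] by auto
qed

lemma weighted_sum_cons_alive:
  assumes "0 \<notin> X"
  shows "(\<Sum>L\<leftarrow>cons_alive s m Ls. weighted_sum (num_outcomes X es) L) =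
    m * int (num_outcomes X es s) + (\<Sum>L\<leftarrow>Ls. weighted_sum (num_outcomes X es) L)"
  by (cases "(s, m, Ls)" rule: cons_alive.cases) (auto simp: num_outcomes_weight_zero[OF assms])

lemma weighted_sum_map_add_edge:
  assumes "0 \<notin> X"
  shows "(\<Sum>K\<leftarrow>map_add_edge e L. weighted_sum (num_outcomes X es) K) =
    weighted_sum (\<lambda>s. num_outcomes X es (add_edge e s)) L"
  by (induction e L rule: map_add_edge.induct) (simp_all add: weighted_sum_cons_alive[OF assms])

lemma weighted_sum_num_outcomes_Cons:
  "weighted_sum (num_outcomes X (e # es)) L =
    weighted_sum (num_outcomes X es) L + weighted_sum (\<lambda>s. num_outcomes X es (add_edge e s)) L"
  by (induction L) (auto simp: algebra_simps)

text \<open>The pairing is invariant: an edge processed in the layer disappears from the argument of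
  \<open>num_outcomes\<close>, and the two branches for this edge are the two layers being
  merged.\<close>

lemma weighted_sum_add_edges:
  assumes "0 \<notin> X"
  shows "weighted_sum (num_outcomes X es') (add_edges es L) = weighted_sum (num_outcomes X (es @ es')) L"
proof (induction es L rule: add_edges.induct)
  case (2 e es L)
  then show ?case
    by (simp only: add_edges.simps weighted_sum_merge weighted_sum_merge_all
        weighted_sum_map_add_edge[OF assms] weighted_sum_num_outcomes_Cons append_Cons)
qed simp

lemma weighted_sum_tally:
  "weighted_sum \<phi> (tally v m h) = m * int (\<phi> v) + weighted_sum \<phi> h"
  "(r = EQ \<longrightarrow> h \<noteq> [] \<longrightarrow> fst (hd h) = v) \<Longrightarrow>
    weighted_sum \<phi> (tally_by r v m h) = m * int (\<phi> v) + weighted_sum \<phi> h"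
  by (induction v m h and r v m h rule: tally_tally_by.induct) (auto simp: compare_eq algebra_simps)

lemma weighted_sum_tally_positive:
  assumes "0 \<notin> X"
  shows "weighted_sum (\<lambda>v. of_bool (v \<in> X)) (tally_positive v m h) =
    m * of_bool (v \<in> X) + weighted_sum (\<lambda>v. of_bool (v \<in> X)) h"
  using assms by (cases v) (auto simp: weighted_sum_tally)

lemma weighted_sum_tally_outcomes:
  assumes "0 \<notin> X"
  shows "weighted_sum (\<lambda>v. of_bool (v \<in> X)) (tally_outcomes es s m h) =
    m * int (num_outcomes X es s) + weighted_sum (\<lambda>v. of_bool (v \<in> X)) h"
proof (induction es s m h rule: tally_outcomes.induct)
  case (1 s m h)
  then show ?case
    by (simp add: weighted_sum_tally_positive[OF assms])
next
  case (2 e es ls m h)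
  then show ?case
    by (simp add: num_outcomes_weight_zero[OF assms] del: num_outcomes.simps)
next
  case (3 e es c ls m h)
  then show ?case
    by (simp add: algebra_simps)
qed

lemma weighted_sum_tally_layer:
  assumes "0 \<notin> X"
  shows "weighted_sum (\<lambda>v. of_bool (v \<in> X)) (tally_layer es L h) =
    weighted_sum (num_outcomes X es) L + weighted_sum (\<lambda>v. of_bool (v \<in> X)) h"
  by (induction es L h rule: tally_layer.induct)
    (simp_all add: weighted_sum_tally_outcomes[OF assms])

text \<open>Vertices 0 to 3 and 4 to 7 are the two classes of the bipartition of the cube graph.
  Edges and space diagonals together form the complete bipartite graph on them, with the diagonals
  \<open>(0, 7)\<close>, \<open>(1, 6)\<close>, \<open>(2, 5)\<close>, \<open>(3, 4)\<close>
  doubled. The edges are ordered by their endpoint in the second class; those at vertex 4 come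
  last.\<close>

definition early_edges :: "(nat \<times> nat) list" where
  "early_edges = [(0, 7), (0, 7), (1, 7), (2, 7), (3, 7),
    (0, 6), (1, 6), (1, 6), (2, 6), (3, 6),
    (0, 5), (1, 5), (2, 5), (2, 5), (3, 5)]"

definition late_edges :: "(nat \<times> nat) list" where
  "late_edges = [(0, 4), (1, 4), (2, 4), (3, 4), (3, 4)]"

text \<open>Merging equal states is quadratic under \<open>code_simp\<close>, hence not done for the last five edges.\<close>

lemma tally_all_edges:
  "tally_layer late_edges (add_edges early_edges [(State 1 [1, 2, 3, 4, 5, 6, 7, 8], 1)]) [] =
    [(2, 93000), (4, 15987), (6, 2664), (8, 19860), (10, 792), (12, 1296), (16, 81)]"
  by code_simp

lemma num_outcomes_all_edges:
  assumes "0 \<notin> X"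
  shows "int (num_outcomes X (early_edges @ late_edges) (State 1 [1..<9])) =
    weighted_sum (\<lambda>v. of_bool (v \<in> X))
      [(2, 93000), (4, 15987), (6, 2664), (8, 19860), (10, 792), (12, 1296), (16, 81)]"
proof -
  have "[1..<9] = [1, 2, 3, 4, 5, 6, 7, 8]"
    by (simp add: upt_rec)
  then show ?thesis
    using weighted_sum_tally_layer[OF assms, of late_edges
        "add_edges early_edges [(State 1 [1, 2, 3, 4, 5, 6, 7, 8], 1)]" "[]"]
    by (simp only: tally_all_edges weighted_sum_add_edges[OF assms]) simp
qed

subsection \<open>Cubes relative to a target\<close>

text \<open>Listing values along \<open>faces\<close> turns functions on faces into lists, which can
  be compared by evaluation; \<open>paint\<close> is the way back.\<close>

definition faces :: "face list" where
  "faces = [Up, Down, Front, Back, Left, Right]"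

fun face_index :: "face \<Rightarrow> nat" where
  "face_index Up = 0"
| "face_index Down = 1"
| "face_index Front = 2"
| "face_index Back = 3"
| "face_index Left = 4"
| "face_index Right = 5"

definition paint :: "'a list \<Rightarrow> face \<Rightarrow> 'a" where
  "paint xs f = xs ! face_index f"

lemma paint_map_faces: "paint (map g faces) = g"
proof
  show "paint (map g faces) f = g f" for f
    by (cases f) (simp_all add: paint_def faces_def)
qed

lemma map_paint_faces:
  assumes "length xs = 6"
  shows "map (paint xs) faces = xs"
  using assms by (auto simp: paint_def faces_def length_Suc_conv numeral_eq_Suc)

lemma set_faces: "set faces = UNIV"
proof -
  have "f \<in> set faces" for f
    by (cases f) (simp_all add: faces_def)
  then show ?thesis by auto
qed

lemma distinct_faces: "distinct faces"
  by (simp add: faces_def)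

lemma bij_paint:
  assumes "distinct xs" "length xs = 6"
  shows "bij (paint xs :: face \<Rightarrow> face)"
proof -
  have "inj (paint xs)"
    using assms distinct_map[of "paint xs" faces] by (simp add: map_paint_faces set_faces)
  moreover have "finite (UNIV :: face set)"
    by (metis set_faces List.finite_set)
  ultimately show ?thesis
    by (simp add: bij_def finite_UNIV_inj_surj)
qed

section \<open>The rotations as a group\<close>

lemma rotation_comp:
  assumes "r \<in> rotations" "s \<in> rotations"
  shows "r \<circ> s \<in> rotations"
  using assms by (induction r) (simp_all add: comp_assoc rotations.intros)

lemma turn_rotations: "turn_vertical \<in> rotations" "turn_horizontal \<in> rotations"
  using rotation_vertical[OF rotation_id] rotation_horizontal[OF rotation_id] by simp_all

lemma turn_vertical_power4: "turn_vertical \<circ> (turn_vertical \<circ> (turn_vertical \<circ> turn_vertical)) = id"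
proof
  show "(turn_vertical \<circ> (turn_vertical \<circ> (turn_vertical \<circ> turn_vertical))) f = id f" for f
    by (cases f) simp_all
qed

lemma turn_horizontal_power4:
  "turn_horizontal \<circ> (turn_horizontal \<circ> (turn_horizontal \<circ> turn_horizontal)) = id"
proof
  show "(turn_horizontal \<circ> (turn_horizontal \<circ> (turn_horizontal \<circ> turn_horizontal))) f = id f" for f
    by (cases f) simp_all
qed

text \<open>Each generator has order four, so its third power undoes it.\<close>

lemma rotation_inverse:
  assumes "r \<in> rotations"
  shows "\<exists>s\<in>rotations. r \<circ> s = id"
  using assms
proof induction
  case rotation_id
  show ?case
    by (intro bexI[of _ id] rotations.rotation_id) simp
next
  case (rotation_vertical r)
  then obtain s where s: "s \<in> rotations" "r \<circ> s = id" by blast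
  have "turn_vertical \<circ> r \<circ> (s \<circ> (turn_vertical \<circ> (turn_vertical \<circ> turn_vertical))) =
      turn_vertical \<circ> (r \<circ> s) \<circ> (turn_vertical \<circ> (turn_vertical \<circ> turn_vertical))"
    by (simp only: comp_assoc)
  also have "\<dots> = id"
    by (simp add: s(2) turn_vertical_power4)
  finally have "turn_vertical \<circ> r \<circ> (s \<circ> (turn_vertical \<circ> (turn_vertical \<circ> turn_vertical))) = id" .
  moreover have "s \<circ> (turn_vertical \<circ> (turn_vertical \<circ> turn_vertical)) \<in> rotations"
    by (intro rotation_comp turn_rotations s(1))
  ultimately show ?case by blast
next
  case (rotation_horizontal r)
  then obtain s where s: "s \<in> rotations" "r \<circ> s = id" by blast
  have "turn_horizontal \<circ> r \<circ> (s \<circ> (turn_horizontal \<circ> (turn_horizontal \<circ> turn_horizontal))) =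
      turn_horizontal \<circ> (r \<circ> s) \<circ> (turn_horizontal \<circ> (turn_horizontal \<circ> turn_horizontal))"
    by (simp only: comp_assoc)
  also have "\<dots> = id"
    by (simp add: s(2) turn_horizontal_power4)
  finally have "turn_horizontal \<circ> r \<circ> (s \<circ> (turn_horizontal \<circ> (turn_horizontal \<circ> turn_horizontal))) = id" .
  moreover have "s \<circ> (turn_horizontal \<circ> (turn_horizontal \<circ> turn_horizontal)) \<in> rotations"
    by (intro rotation_comp turn_rotations s(1))
  ultimately show ?case by blast
qed

lemma equiv_rotation_rel: "equiv colorings rotation_rel"
proof (rule equivI)
  show "rotation_rel \<subseteq> colorings \<times> colorings"
    by (auto simp: rotation_rel_def)
  show "refl_on colorings rotation_rel"
    by (auto simp: refl_on_def rotation_rel_def intro!: bexI[of _ id] rotation_id)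
  show "sym rotation_rel"
  proof (rule symI)
    fix c d assume "(c, d) \<in> rotation_rel"
    then obtain r where r: "c \<in> colorings" "d \<in> colorings" "r \<in> rotations" "d = c \<circ> r"
      by (auto simp: rotation_rel_def)
    then obtain s where "s \<in> rotations" "r \<circ> s = id"
      using rotation_inverse by blast
    with r show "(d, c) \<in> rotation_rel"
      by (auto simp: rotation_rel_def comp_assoc intro!: bexI[of _ s])
  qed
  show "trans rotation_rel"
    by (auto simp: trans_def rotation_rel_def comp_assoc intro: rotation_comp)
qed

lemma rotation_moves_Up: "\<exists>r\<in>rotations. r Up = f"
proof -
  note turns = turn_rotations rotation_id rotation_comp
  show ?thesis
  proof (cases f)
    case Up
    then show ?thesis by (intro bexI[of _ id] turns) simp
  next
    case Down
    then show ?thesis by (intro bexI[of _ "turn_horizontal \<circ> turn_horizontal"] turns) simp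
  next
    case Front
    then show ?thesis by (intro bexI[of _ turn_horizontal] turns) simp
  next
    case Back
    then show ?thesis
      by (intro bexI[of _ "turn_horizontal \<circ> (turn_horizontal \<circ> turn_horizontal)"] turns) simp
  next
    case Left
    then show ?thesis
      by (intro bexI[of _ "turn_vertical \<circ> (turn_vertical \<circ> (turn_vertical \<circ> turn_horizontal))"] turns) simp
  next
    case Right
    then show ?thesis by (intro bexI[of _ "turn_vertical \<circ> turn_horizontal"] turns) simp
  qed
qed

text \<open>The six lists in the second bracket represent the right cosets of the group generated by
  \<open>turn_vertical\<close>, distinguished by the face carried to \<open>Up\<close>. Each is
  followed by the four powers of \<open>turn_vertical\<close>, which makes 24.\<close>

definition rotation_lists :: "face list list" where
  "rotation_lists = concat (map (\<lambda>xs. [xs, map turn_vertical xs, map turn_vertical (map turn_vertical xs),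
      map turn_vertical (map turn_vertical (map turn_vertical xs))])
    [faces, map turn_horizontal faces, map turn_horizontal (map turn_horizontal faces),
     map turn_horizontal (map turn_horizontal (map turn_horizontal faces)),
     map turn_horizontal (map turn_vertical faces),
     map turn_horizontal (map turn_vertical (map turn_vertical (map turn_vertical faces)))])"

lemma rotation_lists_closed:
  "\<forall>xs\<in>set rotation_lists. map turn_vertical xs \<in> set rotation_lists \<and>
    map turn_horizontal xs \<in> set rotation_lists"
  by code_simp

lemma map_rotation_faces:
  assumes "r \<in> rotations"
  shows "map r faces \<in> set rotation_lists"
  using assms
proof induction
  case rotation_id
  show ?case by (simp add: rotation_lists_def)
next
  case (rotation_vertical r)
  then show ?case
    using rotation_lists_closed by (metis map_map)
next
  case (rotation_horizontal r)
  then show ?case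
    using rotation_lists_closed by (metis map_map)
qed

section \<open>The thirty cubes in normal form\<close>

fun selections :: "nat \<Rightarrow> 'a list \<Rightarrow> 'a list list" where
  "selections 0 xs = [[]]"
| "selections (Suc n) xs = concat (map (\<lambda>x. map ((#) x) (selections n (remove1 x xs))) xs)"

lemma mem_selections:
  assumes "distinct ys" "set ys \<subseteq> set xs"
  shows "ys \<in> set (selections (length ys) xs)"
  using assms
proof (induction ys arbitrary: xs)
  case (Cons y ys)
  have "set ys \<subseteq> set (remove1 y xs)"
  proof
    fix z assume "z \<in> set ys"
    then have "z \<noteq> y" "z \<in> set xs" using Cons.prems by auto
    then show "z \<in> set (remove1 y xs)" by simp
  qed
  then show ?case
    using Cons by auto
qed simp

text \<open>With the target painted by \<open>faces\<close>, each cube has exactly one painting whose upper face is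
  \<open>Up\<close> and whose front face is the first one available. The first list consists of the cubes that
  share two vertices with the target, in the order of the edges, the second one of the cubes that
  share none.\<close>

definition edge_paintings :: "face list list" where
  "edge_paintings = [
    [Up, Back, Down, Right, Left, Front], [Up, Left, Down, Front, Right, Back],
    [Up, Down, Front, Left, Right, Back], [Up, Left, Down, Right, Front, Back],
    [Up, Back, Down, Front, Left, Right], [Up, Down, Front, Left, Back, Right],
    [Up, Front, Down, Left, Right, Back], [Up, Right, Down, Back, Left, Front],
    [Up, Front, Down, Back, Right, Left], [Up, Right, Down, Left, Back, Front],
    [Up, Left, Down, Right, Back, Front], [Up, Front, Down, Back, Left, Right],
    [Up, Front, Down, Right, Back, Left], [Up, Left, Down, Back, Front, Right],
    [Up, Down, Front, Right, Back, Left], [Up, Back, Down, Front, Right, Left],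
    [Up, Right, Down, Left, Front, Back], [Up, Down, Front, Right, Left, Back],
    [Up, Back, Down, Left, Front, Right], [Up, Right, Down, Front, Back, Left]]"

definition disjoint_paintings :: "face list list" where
  "disjoint_paintings = [
    [Up, Down, Front, Back, Right, Left], [Up, Front, Down, Left, Back, Right],
    [Up, Front, Down, Right, Left, Back], [Up, Back, Down, Left, Right, Front],
    [Up, Back, Down, Right, Front, Left], [Up, Left, Down, Front, Back, Right],
    [Up, Left, Down, Back, Right, Front], [Up, Right, Down, Front, Left, Back],
    [Up, Right, Down, Back, Front, Left]]"

definition paintings :: "face list list" where
  "paintings = faces # edge_paintings @ disjoint_paintings"

text \<open>Once \<open>Up\<close> is on top, 120 arrangements of the other faces remain, in 30
  orbits under the four turns about the vertical axis.\<close>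

lemma paintings_cover:
  "\<forall>zs\<in>set (selections 5 [Down, Front, Back, Left, Right]).
    \<exists>xs\<in>set [faces, map turn_vertical faces, map turn_vertical (map turn_vertical faces),
      map turn_vertical (map turn_vertical (map turn_vertical faces))].
    map (paint (Up # zs)) xs \<in> set paintings"
  by code_simp

lemma paintings_unique:
  "\<forall>p\<in>set paintings. \<forall>xs\<in>set rotation_lists.
    map (paint p) xs \<in> set paintings \<longrightarrow> map (paint p) xs = p"
  by code_simp

lemma distinct_paintings: "distinct paintings"
  by code_simp

lemma length_paintings: "length paintings = 30"
  by code_simp

lemma paintings_permutations: "\<forall>p\<in>set paintings. distinct p \<and> length p = 6"
  by code_simp

section \<open>Corner numbers and cyclic triples of faces\<close>

definition vertex_list :: "(face \<times> face \<times> face) list" where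
  "vertex_list = [
    (Up, Right, Front), (Up, Left, Back), (Down, Left, Front), (Down, Right, Back),
    (Up, Front, Left), (Up, Back, Right), (Down, Front, Right), (Down, Back, Left)]"

lemma set_vertex_list: "set vertex_list = vertices"
  by (auto simp: vertex_list_def vertices_def)

fun cyclic_eq :: "'a \<times> 'a \<times> 'a \<Rightarrow> 'a \<times> 'a \<times> 'a \<Rightarrow> bool" where
  "cyclic_eq (a, b, c) w \<longleftrightarrow> w = (a, b, c) \<or> w = (b, c, a) \<or> w = (c, a, b)"

fun map_triple :: "('a \<Rightarrow> 'b) \<Rightarrow> 'a \<times> 'a \<times> 'a \<Rightarrow> 'b \<times> 'b \<times> 'b" where
  "map_triple g (a, b, c) = (g a, g b, g c)"

text \<open>Cyclic triples of faces replace corner numbers here, so that one evaluation is valid for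
  every coloring of the target.\<close>

definition shared_vertices :: "face list \<Rightarrow> nat list" where
  "shared_vertices p =
    filter (\<lambda>x. \<exists>u\<in>set vertex_list. cyclic_eq (map_triple (paint p) u) (vertex_list ! x))
      [0, 1, 2, 3, 4, 5, 6, 7]"

lemma map_shared_vertices_paintings:
  "map shared_vertices paintings =
    [0, 1, 2, 3, 4, 5, 6, 7] # map (\<lambda>(x, y). [x, y]) (early_edges @ late_edges) @ replicate 9 []"
  by code_simp

text \<open>This is why a cube has eight distinct corner numbers.\<close>

lemma vertex_list_cyclic_distinct:
  "\<forall>x\<in>set [0, 1, 2, 3, 4, 5, 6, 7]. \<forall>y\<in>set [0, 1, 2, 3, 4, 5, 6, 7].
    cyclic_eq (vertex_list ! x) (vertex_list ! y) \<longrightarrow> x = y"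
  by code_simp

lemma three_digit_inject:
  assumes "b \<le> 9" "c \<le> 9" "e \<le> 9" "f \<le> 9" "three_digit a b c = three_digit d e f"
  shows "a = d \<and> b = e \<and> c = f"
proof -
  have eq: "100 * a + 10 * b + c = 100 * d + 10 * e + f"
    using assms(5) by (simp add: three_digit_def)
  have "a = d"
    using eq assms(1-4) by linarith
  moreover from this have "b = e"
    using eq assms(1-4) by linarith
  ultimately show ?thesis
    using eq by simp
qed

lemma corner_number_cases:
  "corner_number a b c \<in> {three_digit a b c, three_digit b c a, three_digit c a b}"
  unfolding corner_number_def by (rule Min_in) auto

text \<open>The minimum is itself the value of one of the three rotations, and digits up to 9 can be
  read off from that value.\<close>

lemma corner_number_eq_iff:
  assumes "a \<le> 9" "b \<le> 9" "c \<le> 9" "d \<le> 9" "e \<le> 9" "f \<le> 9"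
  shows "corner_number a b c = corner_number d e f \<longleftrightarrow> cyclic_eq (a, b, c) (d, e, f)"
proof
  assume "corner_number a b c = corner_number d e f"
  then show "cyclic_eq (a, b, c) (d, e, f)"
    using corner_number_cases[of a b c] corner_number_cases[of d e f] assms
    by (auto dest!: three_digit_inject[rotated 4])
next
  assume "cyclic_eq (a, b, c) (d, e, f)"
  then show "corner_number a b c = corner_number d e f"
    by (auto simp: corner_number_rotate)
qed

definition triple_corner_number :: "nat \<times> nat \<times> nat \<Rightarrow> nat" where
  "triple_corner_number = (\<lambda>(a, b, c). corner_number a b c)"

lemma coloring_corner_numbers_eq:
  "coloring_corner_numbers c = (\<lambda>u. triple_corner_number (map_triple c u)) ` vertices"
  unfolding coloring_corner_numbers_def triple_corner_number_def
  by (intro image_cong) auto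

lemma triple_corner_number_eq_iff:
  assumes "t \<in> colorings"
  shows "triple_corner_number (map_triple t u) = triple_corner_number (map_triple t w) \<longleftrightarrow> cyclic_eq u w"
proof -
  have "bij_betw t UNIV {1..6}"
    using assms by (simp add: colorings_def)
  then have range: "t f \<in> {1..6}" and inj: "t f = t g \<longleftrightarrow> f = g" for f g
    by (auto simp: bij_betw_def inj_on_def)
  have "t f \<le> 9" for f
    using range[of f] by simp
  then show ?thesis
    by (cases u; cases w) (simp add: triple_corner_number_def corner_number_eq_iff inj)
qed

text \<open>Every coloring is \<open>t\<close> composed with a permutation of the faces, so a cube
  is described by its arrangement of the faces of the target.\<close>

definition relative_cube :: "(face \<Rightarrow> nat) \<Rightarrow> face list \<Rightarrow> cube" where
  "relative_cube t p = rotation_rel `` {t \<circ> paint p}"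

lemma coloring_comp_bij:
  assumes "t \<in> colorings" "bij q"
  shows "t \<circ> q \<in> colorings"
  using assms bij_betw_trans by (auto simp: colorings_def)

lemma coloring_paintings:
  assumes "t \<in> colorings" "p \<in> set paintings"
  shows "t \<circ> paint p \<in> colorings"
  using assms paintings_permutations by (intro coloring_comp_bij bij_paint) auto

lemma macmahon_cubes_eq:
  assumes t: "t \<in> colorings"
  shows "macmahon_cubes = relative_cube t ` set paintings"
proof (intro equalityI subsetI)
  fix C assume "C \<in> relative_cube t ` set paintings"
  then show "C \<in> macmahon_cubes"
    using coloring_paintings[OF t] by (auto simp: macmahon_cubes_def relative_cube_def intro: quotientI)
next
  fix C assume "C \<in> macmahon_cubes"
  then obtain c where c: "c \<in> colorings" and C: "C = rotation_rel `` {c}"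
    unfolding macmahon_cubes_def by (rule quotientE)
  define q where "q = the_inv t \<circ> c"
  have bij_t: "bij_betw t UNIV {1..6}" and bij_c: "bij_betw c UNIV {1..6}"
    using t c by (simp_all add: colorings_def)
  then have bij_q: "bij q"
    unfolding q_def using bij_betw_trans bij_betw_the_inv_into by blast
  have c_eq: "c = t \<circ> q"
  proof
    fix f
    have "c f \<in> range t"
      using bij_t bij_c by (auto simp: bij_betw_def)
    then show "c f = (t \<circ> q) f"
      using bij_t by (simp add: q_def bij_betw_def f_the_inv_into_f)
  qed
  \<comment> \<open>The face painted like the top of the target is rotated to the top;
    \<open>q \<circ> r\<close> then fixes \<open>Up\<close>, as \<open>paintings_cover\<close>
    requires.\<close>
  obtain f where f: "q f = Up"
    using bij_q by (metis bij_pointE)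
  obtain r where r: "r \<in> rotations" "r Up = f"
    using rotation_moves_Up by blast
  obtain s where s: "s \<in> rotations" "r \<circ> s = id"
    using rotation_inverse r(1) by blast
  have fin: "finite (UNIV :: face set)"
    by (metis set_faces List.finite_set)
  have "surj r"
    using s(2) by (metis comp_apply id_apply surjI)
  then have "bij r"
    using fin finite_UNIV_surj_inj by (auto simp: bij_def)
  then have bij_qr: "bij (q \<circ> r)"
    using bij_q bij_comp by blast
  define zs where "zs = map (q \<circ> r) [Down, Front, Back, Left, Right]"
  have Up_zs: "map (q \<circ> r) faces = Up # zs"
    using r f by (simp add: faces_def zs_def)
  have dist: "distinct (Up # zs)"
    unfolding Up_zs[symmetric] using bij_qr distinct_faces
    by (auto simp: distinct_map bij_def intro: inj_on_subset)
  have "set zs \<subseteq> set [Down, Front, Back, Left, Right]"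
  proof
    fix g assume "g \<in> set zs"
    then have "g \<noteq> Up" using dist by auto
    then show "g \<in> set [Down, Front, Back, Left, Right]" by (cases g) auto
  qed
  then have "zs \<in> set (selections (length zs) [Down, Front, Back, Left, Right])"
    using dist by (intro mem_selections) simp_all
  moreover have "length zs = 5"
    by (simp add: zs_def)
  ultimately have "zs \<in> set (selections 5 [Down, Front, Back, Left, Right])"
    by (simp only:)
  then obtain xs where xs: "xs \<in> set [faces, map turn_vertical faces,
      map turn_vertical (map turn_vertical faces),
      map turn_vertical (map turn_vertical (map turn_vertical faces))]"
    and p: "map (paint (Up # zs)) xs \<in> set paintings"
    using paintings_cover by blast
  have "\<exists>v\<in>rotations. xs = map v faces"
  proof -
    have "xs = map id faces \<or> xs = map turn_vertical faces \<or>
        xs = map (turn_vertical \<circ> turn_vertical) faces \<or>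
        xs = map (turn_vertical \<circ> (turn_vertical \<circ> turn_vertical)) faces"
      using xs by (simp add: comp_def)
    then show ?thesis
      using rotation_id turn_rotations(1) rotation_comp by blast
  qed
  then obtain v where v: "v \<in> rotations" "xs = map v faces" by blast
  define p' where "p' = map (paint (Up # zs)) xs"
  have "paint p' = q \<circ> r \<circ> v"
    unfolding p'_def v(2) Up_zs[symmetric] paint_map_faces map_map by (rule refl)
  then have "t \<circ> paint p' = c \<circ> (r \<circ> v)"
    by (simp add: c_eq comp_assoc)
  then have "(c, t \<circ> paint p') \<in> rotation_rel"
    using c coloring_paintings[OF t p] rotation_comp[OF r(1) v(1)]
    by (auto simp: rotation_rel_def p'_def)
  then have "C = relative_cube t p'"
    using equiv_class_eq[OF equiv_rotation_rel] C by (simp add: relative_cube_def)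
  then show "C \<in> relative_cube t ` set paintings"
    using p by (simp add: p'_def)
qed

text \<open>The injective \<open>t\<close> cancels, which leaves a statement on face lists that
  \<open>paintings_unique\<close> decides.\<close>

lemma inj_on_relative_cube:
  assumes t: "t \<in> colorings"
  shows "inj_on (relative_cube t) (set paintings)"
proof (rule inj_onI)
  fix p p' assume p: "p \<in> set paintings" "p' \<in> set paintings" "relative_cube t p = relative_cube t p'"
  then have "(t \<circ> paint p, t \<circ> paint p') \<in> rotation_rel"
    using eq_equiv_class_iff[OF equiv_rotation_rel] coloring_paintings[OF t]
    by (simp add: relative_cube_def)
  then obtain r where r: "r \<in> rotations" "t \<circ> paint p' = t \<circ> paint p \<circ> r"
    by (auto simp: rotation_rel_def)
  have "inj t"
    using t by (simp add: colorings_def bij_betw_def)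
  then have "paint p' = paint p \<circ> r"
    using r(2) by (simp add: fun_eq_iff inj_eq)
  then have "map (paint p') faces = map (paint p) (map r faces)"
    by simp
  moreover have "map (paint p') faces = p'"
    using p(2) paintings_permutations by (simp add: map_paint_faces)
  ultimately have "p' = map (paint p) (map r faces)" by simp
  with paintings_unique p(1,2) map_rotation_faces[OF r(1)] show "p = p'" by metis
qed

lemma corner_numbers_relative_cube:
  assumes "t \<in> colorings" "p \<in> set paintings"
  shows "corner_numbers (relative_cube t p) =
    (\<lambda>u. triple_corner_number (map_triple t (map_triple (paint p) u))) ` vertices"
proof -
  have "relative_cube t p \<in> macmahon_cubes"
    using assms by (simp add: macmahon_cubes_eq)
  moreover have "t \<circ> paint p \<in> relative_cube t p"
    using equiv_class_self[OF equiv_rotation_rel] coloring_paintings[OF assms]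
    by (simp add: relative_cube_def)
  ultimately have "corner_numbers (relative_cube t p) = coloring_corner_numbers (t \<circ> paint p)"
    by (rule corner_numbers_eq)
  also have "\<dots> = (\<lambda>u. triple_corner_number (map_triple t (map_triple (paint p) u))) ` vertices"
    unfolding coloring_corner_numbers_eq by (intro image_cong) auto
  finally show ?thesis .
qed

subsection \<open>Collections\<close>

text \<open>Removing \<open>T\<close> is injective since all sets counted have size
  \<open>n\<close>. Of \<open>U\<close> and \<open>insert T U\<close> at most one has
  \<open>n\<close> members, so at most one summand is nonzero and it is the count of the original
  set. Members of \<open>D\<close> have no admissible vertex and cannot occur.\<close>

lemma card_matchable_subsets:
  fixes I :: "'c \<Rightarrow> nat set" and n :: nat
  defines "N \<equiv> \<lambda>W. card (matchings I W {..<n})"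
  assumes M: "M = insert T (A \<union> D)" "finite M" and T: "T \<notin> A"
    and D: "\<And>C. C \<in> D \<Longrightarrow> I C = {}" and X: "0 \<notin> X"
  shows "card {W. W \<subseteq> M \<and> card W = n \<and> N W \<in> X} =
    card {U. U \<subseteq> A \<and> N U + N (insert T U) \<in> X}"
proof -
  have card_N: "card W = n" if "N W \<noteq> 0" for W
    using card_eq_if_matching[of I W "{..<n}"] that by (simp add: N_def)
  have fin: "finite W" if "W \<subseteq> M" for W
    using that M(2) finite_subset by blast
  let ?L = "{W. W \<subseteq> M \<and> card W = n \<and> N W \<in> X}"
  let ?R = "{U. U \<subseteq> A \<and> N U + N (insert T U) \<in> X}"
  have "bij_betw (\<lambda>W. W - {T}) ?L ?R"
  proof (rule bij_betw_imageI)
    show "inj_on (\<lambda>W. W - {T}) ?L"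
    proof (rule inj_onI)
      fix W W' assume W: "W \<in> ?L" "W' \<in> ?L" "W - {T} = W' - {T}"
      have "card (W - {T}) = card (W' - {T})" "card W = card W'" "finite W" "finite W'"
        using W fin by auto
      then have "T \<in> W \<longleftrightarrow> T \<in> W'"
        by (metis Diff_empty Diff_insert0 card_Diff1_less less_irrefl)
      with W(3) show "W = W'" by blast
    qed
    show "(\<lambda>W. W - {T}) ` ?L = ?R"
    proof (intro equalityI subsetI)
      fix U assume "U \<in> (\<lambda>W. W - {T}) ` ?L"
      then obtain W where W: "W \<subseteq> M" "card W = n" "N W \<in> X" and U: "U = W - {T}" by blast
      have pos: "N W \<noteq> 0" using W(3) X by metis
      have "C \<notin> D" if "C \<in> W" for C
        using incident_if_matching[of I W "{..<n}" C] D that pos by (auto simp: N_def)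
      then have "U \<subseteq> A" using W(1) M(1) U by blast
      moreover have "N U + N (insert T U) = N W"
      proof (cases "T \<in> W")
        case True
        then have "card U \<noteq> n"
          using W(2) fin[OF W(1)] U card_Diff1_less[of W T] by auto
        then have "N U = 0" using card_N by blast
        with True U show ?thesis by (simp add: insert_absorb)
      next
        case False
        then have "card (insert T U) \<noteq> n"
          using W(2) fin[OF W(1)] U by simp
        then have "N (insert T U) = 0" using card_N by blast
        with False U show ?thesis by simp
      qed
      ultimately show "U \<in> ?R" using W(3) by simp
    next
      fix U assume U: "U \<in> ?R"
      then have TU: "T \<notin> U" and UM: "U \<subseteq> M" "insert T U \<subseteq> M" using T M(1) by auto
      show "U \<in> (\<lambda>W. W - {T}) ` ?L"
      proof (cases "N U = 0")
        case True
        then have "N (insert T U) \<in> X" using U by simp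
        moreover from this have "card (insert T U) = n" using X card_N by metis
        moreover have "U = insert T U - {T}" using TU by simp
        ultimately show ?thesis using UM by blast
      next
        case False
        then have "card U = n" using card_N by blast
        moreover from this have "N (insert T U) = 0"
          using card_N[of "insert T U"] TU fin[OF UM(1)] by force
        moreover have "U = U - {T}" using TU by simp
        ultimately show ?thesis using U UM by auto
      qed
    qed
  qed
  then show ?thesis by (rule bij_betw_same_card)
qed

lemma card_collections_solution_number:
  assumes T: "T \<in> macmahon_cubes" and X: "0 \<notin> X"
  shows "int (card {W \<in> collections. solution_number T W \<in> X}) =
    weighted_sum (\<lambda>v. of_bool (v \<in> X))
      [(2, 93000), (4, 15987), (6, 2664), (8, 19860), (10, 792), (12, 1296), (16, 81)]"
proof -
  obtain t where t: "t \<in> colorings" and T_eq: "T = rotation_rel `` {t}"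
    using T unfolding macmahon_cubes_def by (rule quotientE)
  have "paint faces = id"
    using paint_map_faces[of id] by simp
  then have T_cube: "T = relative_cube t faces"
    by (simp add: relative_cube_def T_eq)
  define v where "v x = triple_corner_number (map_triple t (vertex_list ! x))" for x
  define I where "I C = {x \<in> {..<8}. v x \<in> corner_numbers C}" for C
  have upto8: "{..<8} = set [0, 1, 2, 3, 4, 5, 6, 7 :: nat]"
    by auto
  have len_vertex: "length vertex_list = 8"
    by (simp add: vertex_list_def)
  have inj_v: "inj_on v {..<8}"
  proof (rule inj_onI)
    fix x y :: nat assume xy: "x \<in> {..<8}" "y \<in> {..<8}" "v x = v y"
    then have "cyclic_eq (vertex_list ! x) (vertex_list ! y)"
      using triple_corner_number_eq_iff[OF t] by (simp add: v_def)
    then show "x = y"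
      using vertex_list_cyclic_distinct xy(1,2) unfolding upto8 by blast
  qed
  have "faces \<in> set paintings"
    by (simp add: paintings_def)
  then have "corner_numbers T = (\<lambda>u. triple_corner_number (map_triple t (map_triple id u))) ` vertices"
    using corner_numbers_relative_cube[OF t, of faces] \<open>paint faces = id\<close> by (simp add: T_cube)
  also have "\<dots> = (\<lambda>u. triple_corner_number (map_triple t u)) ` vertices"
    by (intro image_cong) auto
  also have "vertices = (!) vertex_list ` {..<8}"
    using set_vertex_list by (auto simp: set_conv_nth len_vertex)
  finally have corner_T: "corner_numbers T = v ` {..<8}"
    by (simp add: image_image v_def)
  have I_eq: "I (relative_cube t p) = set (shared_vertices p)" if "p \<in> set paintings" for p
  proof -
    have "v x \<in> corner_numbers (relative_cube t p) \<longleftrightarrow>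
        (\<exists>u\<in>set vertex_list. cyclic_eq (map_triple (paint p) u) (vertex_list ! x))" for x
      unfolding corner_numbers_relative_cube[OF t that] v_def set_vertex_list image_iff
      using triple_corner_number_eq_iff[OF t] by metis
    then show ?thesis
      unfolding I_def upto8 shared_vertices_def by (simp only: set_filter)
  qed
  let ?cubes = "map (relative_cube t)"
  have "map I (?cubes paintings) = map set (map shared_vertices paintings)"
    by (simp add: I_eq)
  also have "\<dots> = {..<8} # map (\<lambda>(x, y). {x, y}) (early_edges @ late_edges) @ replicate 9 {}"
    unfolding map_shared_vertices_paintings upto8 by (simp add: case_prod_unfold)
  finally have I_all: "map I (?cubes paintings) =
    {..<8} # map (\<lambda>(x, y). {x, y}) (early_edges @ late_edges) @ replicate 9 {}" .
  have len_edges: "length edge_paintings = length (early_edges @ late_edges)"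
    by (simp add: edge_paintings_def early_edges_def late_edges_def)
  have I_T: "I T = {..<8}"
    using I_all by (simp add: paintings_def T_cube)
  have "map I (?cubes edge_paintings) @ map I (?cubes disjoint_paintings) =
      map (\<lambda>(x, y). {x, y}) (early_edges @ late_edges) @ replicate 9 {}"
    using I_all by (simp add: paintings_def)
  then have "map I (?cubes edge_paintings) = map (\<lambda>(x, y). {x, y}) (early_edges @ late_edges) \<and>
      map I (?cubes disjoint_paintings) = replicate 9 {}"
    using len_edges by (intro append_eq_append_conv[THEN iffD1]) simp_all
  then have I_edges: "map I (?cubes edge_paintings) = map (\<lambda>(x, y). {x, y}) (early_edges @ late_edges)"
    and I_disjoint: "map I (?cubes disjoint_paintings) = replicate 9 {}"
    by blast+
  have edges: "list_all2 (\<lambda>C (x, y). I C = {x, y} \<and> x \<noteq> y \<and> x < 8 \<and> y < 8)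
      (?cubes edge_paintings) (early_edges @ late_edges)"
  proof (rule list_all2_all_nthI)
    show "length (?cubes edge_paintings) = length (early_edges @ late_edges)"
      using len_edges by simp
    fix i assume i: "i < length (?cubes edge_paintings)"
    have "I (?cubes edge_paintings ! i) = (\<lambda>(x, y). {x, y}) ((early_edges @ late_edges) ! i)"
      using arg_cong[OF I_edges, of "\<lambda>L. L ! i"] i len_edges by (simp del: map_append)
    moreover have "case (early_edges @ late_edges) ! i of (x, y) \<Rightarrow> x \<noteq> y \<and> x < 8 \<and> y < 8"
    proof (rule bspec[where A = "set (early_edges @ late_edges)"])
      show "\<forall>(x, y)\<in>set (early_edges @ late_edges). x \<noteq> y \<and> x < 8 \<and> y < 8"
        by (simp add: early_edges_def late_edges_def)
      show "(early_edges @ late_edges) ! i \<in> set (early_edges @ late_edges)"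
        using i len_edges by (intro nth_mem) simp
    qed
    ultimately show "case (early_edges @ late_edges) ! i of
        (x, y) \<Rightarrow> I (?cubes edge_paintings ! i) = {x, y} \<and> x \<noteq> y \<and> x < 8 \<and> y < 8"
      by (simp add: case_prod_unfold)
  qed
  have "distinct (?cubes paintings)"
    using distinct_paintings inj_on_relative_cube[OF t] by (simp add: distinct_map)
  then have dist: "distinct (?cubes edge_paintings)" "T \<notin> set (?cubes edge_paintings)"
    unfolding paintings_def T_cube by auto
  have cubes: "macmahon_cubes =
      insert T (set (?cubes edge_paintings) \<union> set (?cubes disjoint_paintings))"
    unfolding macmahon_cubes_eq[OF t] paintings_def T_cube by auto
  have fin: "finite macmahon_cubes"
    by (simp add: macmahon_cubes_eq[OF t])
  have "solution_number T W = card (matchings I W {..<8})" if "W \<subseteq> macmahon_cubes" for W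
  proof -
    have "solution_number T W = card (matchings corner_numbers W (v ` {..<8}))"
      by (simp add: solution_number_def solutions_def matchings_def corner_T)
    also have "\<dots> = card (matchings I W {..<8})"
      unfolding I_def using inj_v that fin finite_subset
      by (intro card_matchings_image) auto
    finally show ?thesis .
  qed
  then have "{W \<in> collections. solution_number T W \<in> X} =
      {W. W \<subseteq> macmahon_cubes \<and> card W = 8 \<and> card (matchings I W {..<8}) \<in> X}"
    by (auto simp: collections_def)
  also have "card \<dots> = card {U. U \<subseteq> set (?cubes edge_paintings) \<and>
      card (matchings I U {..<8}) + card (matchings I (insert T U) {..<8}) \<in> X}"
  proof (rule card_matchable_subsets[OF cubes fin dist(2) _ X])
    fix C assume "C \<in> set (?cubes disjoint_paintings)"
    then have "I C \<in> set (map I (?cubes disjoint_paintings))" by auto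
    then show "I C = {}" unfolding I_disjoint by simp
  qed
  also have "\<dots> = num_outcomes X (early_edges @ late_edges) (State 1 [1..<Suc 8])"
    using card_subsets_eq_num_outcomes[OF edges represents_empty finite.emptyI dist(1) _ _ dist(2) I_T]
    by simp
  also have "Suc 8 = 9" by simp
  finally show ?thesis
    using num_outcomes_all_edges[OF X] by simp
qed

lemma card_collections: "card collections = 30 choose 8"
proof -
  \<comment> \<open>The cubes are enumerated relative to a coloring, so one has to be
    exhibited.\<close>
  have "paint [1..<7] \<in> colorings"
  proof -
    have "map (paint [1..<7]) faces = [1..<7]"
      by (intro map_paint_faces) simp
    then have "inj_on (paint [1..<7]) (set faces)" "paint [1..<7] ` set faces = {1..<7}"
      using distinct_map[of "paint [1..<7]" faces] set_map[of "paint [1..<7]" faces] by simp_all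
    then show ?thesis
      by (auto simp: colorings_def bij_betw_def set_faces)
  qed
  then have "card macmahon_cubes = 30"
    using macmahon_cubes_eq card_image[OF inj_on_relative_cube] distinct_card[OF distinct_paintings]
    by (simp add: length_paintings)
  moreover from this have "finite macmahon_cubes"
    by (simp add: card_ge_0_finite)
  ultimately show ?thesis
    by (simp add: collections_def n_subsets)
qed

theorem theorem1:
  assumes "T \<in> macmahon_cubes"
  shows "card collections = 30 choose 8 \<and> (30 choose 8 :: nat) = 5852925
    \<and> card {W \<in> collections. solution_number T W > 0} = 133680
    \<and> Max {solution_number T W | W. W \<in> collections} = 16
    \<and> card {W \<in> collections. solution_number T W = 16} = 81
    \<and> Min {solution_number T W | W. W \<in> collections \<and> solution_number T W > 0} = 2
    \<and> card {W \<in> collections. solution_number T W = 2} = 93000"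
proof -
  note count = card_collections_solution_number[OF assms]
  have choose: "(30 choose 8 :: nat) = 5852925"
    using binomial_fact_lemma[of 8 30] by (simp add: fact_numeral)
  then have fin: "finite collections"
    using card_collections card.infinite by fastforce
  have positive: "card {W \<in> collections. solution_number T W > 0} = 133680"
    using count[of "{0<..}"] by simp
  \<comment> \<open>By hand, 81 = 1 + 8 + 72. Either all four diagonals are doubled, or the target
    joins a tree. The tree is one copy of a diagonal with the other three doubled (4 * 2 choices),
    or it spans the ends of two diagonals with the other two doubled (6 * 12 choices).\<close>
  have card16: "card {W \<in> collections. solution_number T W = 16} = 81"
    using count[of "{16}"] by simp
  have card2: "card {W \<in> collections. solution_number T W = 2} = 93000"
    using count[of "{2}"] by simp
  have "card {W \<in> collections. solution_number T W \<in> {16<..}} = 0"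
    using count[of "{16<..}"] by simp
  then have le16: "solution_number T W \<le> 16" if "W \<in> collections" for W
    using that fin by force
  have "card {W \<in> collections. solution_number T W \<in> {1}} = 0"
    using count[of "{1}"] by simp
  then have not1: "solution_number T W \<noteq> 1" if "W \<in> collections" for W
    using that fin by force
  have "Max {solution_number T W | W. W \<in> collections} = 16"
  proof (rule Max_eqI)
    have "{W \<in> collections. solution_number T W = 16} \<noteq> {}"
      using card16 by force
    then show "16 \<in> {solution_number T W | W. W \<in> collections}" by force
  qed (use fin le16 in auto)
  moreover have "Min {solution_number T W | W. W \<in> collections \<and> solution_number T W > 0} = 2"
  proof (rule Min_eqI)
    have "{W \<in> collections. solution_number T W = 2} \<noteq> {}"
      using card2 by force
    then show "2 \<in> {solution_number T W | W. W \<in> collections \<and> solution_number T W > 0}" by force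
    fix m assume "m \<in> {solution_number T W | W. W \<in> collections \<and> solution_number T W > 0}"
    then obtain W where "W \<in> collections" "m = solution_number T W" "m > 0" by blast
    then show "2 \<le> m"
      using not1[of W] by linarith
  qed (use fin in auto)
  ultimately show ?thesis
    using card_collections choose positive card16 card2 by blast
qed

end
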